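(* Let $(\overline W,\overline S)$ be a Coxeter system whose Coxeter diagram is a star, with root system $\overline\Phi$, simple roots $\alpha_1$ and $\alpha_{(i,j)}$ ($1\le i\le r$, $1\le j\le p_i$), and set of reflections $\overline T$. The parabolic subgroup $P:=\langle s_{ij}\mid1\le i\le r,1\le j\le p_i\rangle$ of $\overline W$ acts transitively on the set of roots $(\alpha_1+\Lambda)\cap\overline\Phi$, where $\Lambda:=\mathrm{span}_{\mathbb Z}(\alpha_{(i,j)}\mid1\le i\le r,1\le j\le p_i)$. In particular, $P$ acts by conjugation transitively on the set of reflections $\{t\in\overline T\mid\overline W=\langle P,t\rangle\}$.
   Context: Let $r\ge0$ and $p_1,\ldots,p_r\ge1$ be integers. The (simply laced) Coxeter diagram of $(\overline W,\overline S)$ is the star with vertices $1$ and $(i,j)$ ($1\le i\le r$, $1\le j\le p_i$), with edges joining $1$ and $(i,1)$ for all $i$, and $(i,j)$ and $(i,j+1)$ for $1\le j<p_i$. $\overline W$ acts on the real vector space with basis the simple roots $\alpha_1,\alpha_{(i,j)}$ and symmetric form taking value $2$ on each simple root with itself, $-1$ on adjacent ones, $0$ on non-adjacent distinct ones; $s_1$ and $s_{ij}$ are the reflections $s_\alpha(v)=v-(\alpha\mid v)\alpha$ for $\alpha=\alpha_1$, $\alpha=\alpha_{(i,j)}$; $\overline S$ is the set of these and $\overline W$ is generated by $\overline S$. $\overline\Phi$ is the set of all $\overline W$-images of the simple roots, and $\overline T=\bigcup_{w\in\overline W}w\overline Sw^{-1}$. *)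

theory Defs
  imports Complex_Main "HOL-Algebra.Group_Action" "HOL-Algebra.Generated_Groups"
begin

text \<open>
  A star with \<open>r\<close> arms, the \<open>i\<close>-th of which (\<open>1 \<le> i \<le> r\<close>) has \<open>p i\<close> vertices besides the
  centre. \<open>Centre\<close> is the vertex written 1 and \<open>Arm i j\<close> the vertex written \<open>(i, j)\<close>.
\<close>

datatype vertex = Centre | Arm nat nat

definition arm_vertices :: "nat \<Rightarrow> (nat \<Rightarrow> nat) \<Rightarrow> vertex set" where
  "arm_vertices r p = {Arm i j | i j. i \<in> {1..r} \<and> j \<in> {1..p i}}"

definition vertices :: "nat \<Rightarrow> (nat \<Rightarrow> nat) \<Rightarrow> vertex set" where
  "vertices r p = insert Centre (arm_vertices r p)"

definition edges :: "nat \<Rightarrow> (nat \<Rightarrow> nat) \<Rightarrow> vertex set set" where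
  "edges r p = {{Centre, Arm i 1} | i. i \<in> {1..r}}
             \<union> {{Arm i j, Arm i (j + 1)} | i j. i \<in> {1..r} \<and> 1 \<le> j \<and> j < p i}"

text \<open>
  The real vector space with basis the simple roots: a vector is the function giving its
  coordinates, and vanishes outside the vertex set.
\<close>

definition space :: "nat \<Rightarrow> (nat \<Rightarrow> nat) \<Rightarrow> (vertex \<Rightarrow> real) set" where
  "space r p = {v. \<forall>x. x \<notin> vertices r p \<longrightarrow> v x = 0}"

definition simple_root :: "vertex \<Rightarrow> vertex \<Rightarrow> real" where
  "simple_root a = (\<lambda>x. if x = a then 1 else 0)"

definition gram :: "nat \<Rightarrow> (nat \<Rightarrow> nat) \<Rightarrow> vertex \<Rightarrow> vertex \<Rightarrow> real" where
  "gram r p a b = (if a = b then 2 else if {a, b} \<in> edges r p then -1 else 0)"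

definition form :: "nat \<Rightarrow> (nat \<Rightarrow> nat) \<Rightarrow> (vertex \<Rightarrow> real) \<Rightarrow> (vertex \<Rightarrow> real) \<Rightarrow> real" where
  "form r p u v = (\<Sum>a\<in>vertices r p. \<Sum>b\<in>vertices r p. u a * v b * gram r p a b)"

text \<open>
  Group elements are bijections of \<^term>\<open>space r p\<close> in the sense of \<^const>\<open>BijGroup\<close>, hence
  undefined outside that set.
\<close>

definition reflection ::
    "nat \<Rightarrow> (nat \<Rightarrow> nat) \<Rightarrow> (vertex \<Rightarrow> real) \<Rightarrow> (vertex \<Rightarrow> real) \<Rightarrow> (vertex \<Rightarrow> real)" where
  "reflection r p \<alpha> = (\<lambda>v\<in>space r p. \<lambda>x. v x - form r p \<alpha> v * \<alpha> x)"

definition S_bar :: "nat \<Rightarrow> (nat \<Rightarrow> nat) \<Rightarrow> ((vertex \<Rightarrow> real) \<Rightarrow> (vertex \<Rightarrow> real)) set" where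
  "S_bar r p = (\<lambda>a. reflection r p (simple_root a)) ` vertices r p"

definition W_bar :: "nat \<Rightarrow> (nat \<Rightarrow> nat) \<Rightarrow> ((vertex \<Rightarrow> real) \<Rightarrow> (vertex \<Rightarrow> real)) monoid" where
  "W_bar r p = (BijGroup (space r p))
     \<lparr>carrier := generate (BijGroup (space r p)) (S_bar r p)\<rparr>"

definition P_set :: "nat \<Rightarrow> (nat \<Rightarrow> nat) \<Rightarrow> ((vertex \<Rightarrow> real) \<Rightarrow> (vertex \<Rightarrow> real)) set" where
  "P_set r p = generate (W_bar r p) ((\<lambda>a. reflection r p (simple_root a)) ` arm_vertices r p)"

definition P_group :: "nat \<Rightarrow> (nat \<Rightarrow> nat) \<Rightarrow> ((vertex \<Rightarrow> real) \<Rightarrow> (vertex \<Rightarrow> real)) monoid" where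
  "P_group r p = (W_bar r p) \<lparr>carrier := P_set r p\<rparr>"

definition Phi_bar :: "nat \<Rightarrow> (nat \<Rightarrow> nat) \<Rightarrow> (vertex \<Rightarrow> real) set" where
  "Phi_bar r p = {w (simple_root a) | w a. w \<in> carrier (W_bar r p) \<and> a \<in> vertices r p}"

definition T_bar :: "nat \<Rightarrow> (nat \<Rightarrow> nat) \<Rightarrow> ((vertex \<Rightarrow> real) \<Rightarrow> (vertex \<Rightarrow> real)) set" where
  "T_bar r p = (\<Union>w\<in>carrier (W_bar r p).
     {w \<otimes>\<^bsub>W_bar r p\<^esub> s \<otimes>\<^bsub>W_bar r p\<^esub> inv\<^bsub>W_bar r p\<^esub> w | s. s \<in> S_bar r p})"

definition arm_lattice :: "nat \<Rightarrow> (nat \<Rightarrow> nat) \<Rightarrow> (vertex \<Rightarrow> real) set" where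
  "arm_lattice r p =
     {\<lambda>x. \<Sum>a\<in>arm_vertices r p. of_int (c a) * simple_root a x | c :: vertex \<Rightarrow> int. True}"

definition level_one_roots :: "nat \<Rightarrow> (nat \<Rightarrow> nat) \<Rightarrow> (vertex \<Rightarrow> real) set" where
  "level_one_roots r p =
     {\<lambda>x. simple_root Centre x + l x | l. l \<in> arm_lattice r p} \<inter> Phi_bar r p"

definition complementary_reflections ::
    "nat \<Rightarrow> (nat \<Rightarrow> nat) \<Rightarrow> ((vertex \<Rightarrow> real) \<Rightarrow> (vertex \<Rightarrow> real)) set" where
  "complementary_reflections r p =
     {t \<in> T_bar r p. carrier (W_bar r p) = generate (W_bar r p) (insert t (P_set r p))}"

end

theory Submission
  imports Defs
begin

text \<open>
  Let \<open>c\<^sub>0 = 1, c\<^sub>1, \<dots>, c\<^sub>n, c\<^bsub>n+1\<^esub> = 0\<close> be the coordinates of \<open>v \<in> \<alpha>\<^sub>1 + \<Lambda>\<close> along an arm, read from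
  the centre outwards. In terms of the differences \<open>d\<^sub>j = c\<^sub>j - c\<^bsub>j+1\<^esub>\<close>, which sum to 1 on each
  arm, \<open>(v | v) - 2\<close> is the sum of all \<open>d\<^sub>j\<^sup>2 - d\<^sub>j\<close>. These are non-negative for integers, so if \<open>v\<close> is
  a root, whence \<open>(v | v) = 2\<close>, exactly one difference per arm is 1 and the others vanish. Thus
  \<open>v\<close> is the sum of \<open>\<alpha>\<^sub>1\<close> and an initial segment of every arm, and reflecting the segments away
  from their outer ends takes \<open>v\<close> to \<open>\<alpha>\<^sub>1\<close>.

  A reflection that generates \<open>W\<close> together with \<open>P\<close> belongs to a root of \<open>\<alpha>\<^sub>1\<close>-coordinate 1 or -1,
  hence to one in \<open>\<alpha>\<^sub>1 + \<Lambda>\<close>, and \<open>w s\<^sub>\<beta> w\<^sup>-\<^sup>1 = s\<^bsub>w \<beta>\<^esub>\<close>.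
\<close>

section \<open>Group actions, generation by involutions, and integer sequences\<close>

text \<open>On \<open>E\<close> the map \<open>f (inv g)\<close> is a two-sided inverse of
  \<open>f g\<close>, so the usual action laws already give bijections. The restriction to
  \<open>E\<close> is there because elements of \<open>BijGroup E\<close> are extensional. Both
  evaluation at a root and conjugation of a reflection are treated this way.\<close>

lemma group_action_restrictI:
  fixes G (structure)
  assumes "group G"
    and closed: "\<And>g x. g \<in> carrier G \<Longrightarrow> x \<in> E \<Longrightarrow> f g x \<in> E"
    and one: "\<And>x. x \<in> E \<Longrightarrow> f \<one>\<^bsub>G\<^esub> x = x"
    and mult: "\<And>g h x. g \<in> carrier G \<Longrightarrow> h \<in> carrier G \<Longrightarrow> x \<in> E \<Longrightarrow> f (g \<otimes>\<^bsub>G\<^esub> h) x = f g (f h x)"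
  shows "group_action G E (\<lambda>g. \<lambda>x\<in>E. f g x)"
proof -
  interpret group G by (rule assms(1))
  have bij: "(\<lambda>x\<in>E. f g x) \<in> Bij E" if g: "g \<in> carrier G" for g
  proof -
    have "bij_betw (f g) E E"
    proof (rule bij_betw_byWitness[where f' = "f (inv g)"])
      show "\<forall>a\<in>E. f (inv g) (f g a) = a" "\<forall>a\<in>E. f g (f (inv g) a) = a"
        using g one by (auto simp flip: mult)
    qed (use g closed in auto)
    then show ?thesis
      by (simp add: Bij_def bij_betw_restrict_eq)
  qed
  have "(\<lambda>g. \<lambda>x\<in>E. f g x) \<in> hom G (BijGroup E)"
    using bij by (intro homI) (auto simp: BijGroup_def compose_def mult closed)
  then show ?thesis
    using \<open>group G\<close> group_BijGroup by (intro group_action.intro group_hom.intro group_hom_axioms.intro)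
qed

text \<open>An involution is its own inverse, so the \<open>inv\<close> case of
  \<open>generate\<close> collapses into the case of a generator, and \<open>Q\<close> need not be
  shown stable under inverses.\<close>

lemma (in group) generate_involutions_induct:
  assumes "x \<in> generate G A" "A \<subseteq> carrier G"
    and involution: "\<And>a. a \<in> A \<Longrightarrow> a \<otimes> a = \<one>"
    and "Q \<one>" "\<And>a. a \<in> A \<Longrightarrow> Q a"
    and "\<And>x y. x \<in> generate G A \<Longrightarrow> y \<in> generate G A \<Longrightarrow> Q x \<Longrightarrow> Q y \<Longrightarrow> Q (x \<otimes> y)"
  shows "Q x"
  using assms(1)
proof (induction rule: generate.induct)
  case (inv a)
  then have "inv a = a"
    using assms(2) involution by (intro inv_equality) auto
  then show ?case using assms(5)[OF inv] by simp
qed (use assms in auto)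

text \<open>Summation by parts for the quadratic form of a path. The left side is what the vertices
  of one arm contribute to the norm; the terms outside the sum of squares come from the two ends of
  the chain.\<close>

lemma sum_chain_squares:
  fixes c :: "nat \<Rightarrow> real"
  shows "(\<Sum>j=1..n. c j * (2 * c j - c (j - 1) - c (Suc j)))
    = (\<Sum>j\<le>n. (c j - c (Suc j))\<^sup>2) - (c 0)\<^sup>2 + c 0 * c 1 + c n * c (Suc n) - (c (Suc n))\<^sup>2"
  by (induction n) (auto simp: power2_eq_square algebra_simps)

lemma Ints_square_minus_self_nonneg:
  fixes d :: real
  assumes "d \<in> \<int>"
  shows "0 \<le> d\<^sup>2 - d" and "d\<^sup>2 - d = 0 \<Longrightarrow> d = 0 \<or> d = 1"
proof -
  obtain k where k: "d = of_int k" using assms by (auto elim: Ints_cases)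
  have "0 \<le> k * (k - 1)"
    by (cases "k \<ge> 1") (auto intro: mult_nonneg_nonneg mult_nonpos_nonpos)
  then have "0 \<le> of_int (k * (k - 1)) * (1::real)" by (metis mult.right_neutral of_int_0_le_iff)
  then show "0 \<le> d\<^sup>2 - d" by (simp add: k power2_eq_square algebra_simps)
  show "d\<^sup>2 - d = 0 \<Longrightarrow> d = 0 \<or> d = 1" by (simp add: power2_eq_square)
qed

text \<open>The centre counts as position 0 of every arm, so that the inner neighbour of position
  \<open>j\<close> is position \<open>j - 1\<close> even for \<open>j = 1\<close>.\<close>

definition node :: "nat \<Rightarrow> nat \<Rightarrow> vertex" where
  "node i j = (if j = 0 then Centre else Arm i j)"

text \<open>The shape that every root in \<alpha>\<open>\<^sub>1\<close> + \<Lambda> turns out to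
  have; \<open>k i\<close> is the length of the segment on arm \<open>i\<close>.\<close>

definition stair :: "nat \<Rightarrow> (nat \<Rightarrow> nat) \<Rightarrow> vertex \<Rightarrow> real" where
  "stair r k x = (case x of Centre \<Rightarrow> 1 | Arm i j \<Rightarrow> if i \<in> {1..r} \<and> 1 \<le> j \<and> j \<le> k i then 1 else 0)"

lemma stair_simps [simp]:
  "stair r k Centre = 1"
  "stair r k (Arm i j) = (if i \<in> {1..r} \<and> 1 \<le> j \<and> j \<le> k i then 1 else 0)"
  by (simp_all add: stair_def)

text \<open>The sequence is integral and never increases on its way from 1 to 0, so it takes only
  these two values and drops exactly once.\<close>

lemma integral_steps_stair:
  fixes c :: "nat \<Rightarrow> real"
  assumes steps: "\<And>j. j \<le> n \<Longrightarrow> c j - c (Suc j) \<in> {0, 1}"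
    and ends: "c 0 = 1" "c (Suc n) = 0"
  shows "\<exists>k\<le>n. \<forall>j\<le>Suc n. c j = (if j \<le> k then 1 else 0)"
proof -
  have anti: "c j \<le> c i" if "i \<le> j" "j \<le> Suc n" for i j
    using that
  proof (induction j rule: dec_induct)
    case (step j)
    then show ?case using steps[of j] by auto
  qed simp
  have int: "c j \<in> \<int>" if "j \<le> Suc n" for j
    using that
  proof (induction j)
    case (Suc j)
    moreover have "c (Suc j) = c j \<or> c (Suc j) = c j - 1"
      using steps[of j] Suc.prems by auto
    ultimately show ?case by auto
  qed (simp add: ends)
  have val: "c j = 0 \<or> c j = 1" if "j \<le> Suc n" for j
  proof -
    from int[OF that] obtain m where "c j = of_int m" by (auto elim: Ints_cases)
    then show ?thesis using anti[of 0 j] anti[of j "Suc n"] that ends by auto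
  qed
  \<comment> \<open>The last place where the value is still 1; place 0 is such a place, so the
    maximum exists.\<close>
  define k where "k = Max {j. j \<le> n \<and> c j = 1}"
  have k: "k \<in> {j. j \<le> n \<and> c j = 1}"
    unfolding k_def by (rule Max_in) (use ends in auto)
  have "c j = (if j \<le> k then 1 else 0)" if j: "j \<le> Suc n" for j
  proof (cases "j \<le> k")
    case True
    then show ?thesis using anti[of 0 j] anti[of j k] k ends by auto
  next
    case False
    then have "\<not> (j \<le> n \<and> c j = 1)"
      using Max_ge[of "{j. j \<le> n \<and> c j = 1}" j] by (auto simp: k_def)
    then show ?thesis using False val[OF j] j ends le_Suc_eq by auto
  qed
  then show ?thesis using k by auto
qed

subsection \<open>Vectors of norm two on a star\<close>

locale star_diagram =
  fixes r :: nat and p :: "nat \<Rightarrow> nat"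
begin

abbreviation "V \<equiv> vertices r p"
abbreviation "E \<equiv> space r p"
abbreviation "form' \<equiv> form r p"
abbreviation "refl' \<equiv> reflection r p"
abbreviation "W \<equiv> W_bar r p"

text \<open>The integer span of the simple roots: these are the coordinate vectors, so membership is
  integrality of the coordinates.\<close>

definition root_lattice :: "(vertex \<Rightarrow> real) set" where
  "root_lattice = {v \<in> E. \<forall>x. v x \<in> \<int>}"

lemma arm_vertices_image: "arm_vertices r p = case_prod Arm ` (SIGMA i:{1..r}. {1..p i})"
  by (auto simp: arm_vertices_def)

lemma finite_arm_vertices [simp]: "finite (arm_vertices r p)"
  by (simp add: arm_vertices_image)

lemma finite_vertices [simp]: "finite V"
  by (simp add: vertices_def)

lemma Centre_notin_arm [simp]: "Centre \<notin> arm_vertices r p"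
  by (auto simp: arm_vertices_def)

lemma Centre_in_vertices [simp]: "Centre \<in> V"
  by (simp add: vertices_def)

lemma Arm_in_vertices [simp]: "Arm i j \<in> V \<longleftrightarrow> i \<in> {1..r} \<and> j \<in> {1..p i}"
  by (auto simp: vertices_def arm_vertices_def)

lemma arm_subset_vertices: "arm_vertices r p \<subseteq> V"
  by (auto simp: vertices_def)

lemma sum_vertices: "sum f V = f Centre + (\<Sum>i=1..r. \<Sum>j=1..p i. f (Arm i j))"
proof -
  have "sum f (arm_vertices r p) = (\<Sum>(i, j)\<in>(SIGMA i:{1..r}. {1..p i}). f (Arm i j))"
    unfolding arm_vertices_image
    by (subst sum.reindex) (auto simp: inj_on_def case_prod_unfold)
  then show ?thesis
    by (simp add: vertices_def sum.Sigma)
qed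

lemma gram_sym: "gram r p a b = gram r p b a"
  by (simp add: gram_def insert_commute)

lemma form_sym: "form' u v = form' v u"
  unfolding form_def by (subst sum.swap) (simp add: gram_sym mult.commute mult.left_commute)

lemma form_add_left: "form' (\<lambda>x. u x + c * u' x) v = form' u v + c * form' u' v"
  by (simp add: form_def sum_distrib_left sum.distrib algebra_simps)

lemma form_add_right: "form' v (\<lambda>x. u x + c * u' x) = form' v u + c * form' v u'"
  by (simp add: form_sym[of v] form_add_left)

lemma form_uminus_left: "form' (\<lambda>x. - u x) v = - form' u v"
  by (simp add: form_def sum_negf)

lemma form_simple_root:
  "a \<in> V \<Longrightarrow> form' (simple_root a) v = (\<Sum>b\<in>V. v b * gram r p a b)"
proof -
  assume "a \<in> V"
  have "form' (simple_root a) v = (\<Sum>c\<in>V. if c = a then \<Sum>b\<in>V. v b * gram r p c b else 0)"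
    unfolding form_def simple_root_def by (intro sum.cong) auto
  with \<open>a \<in> V\<close> show ?thesis by simp
qed

lemma Centre_Arm_edge: "{Centre, Arm i j} \<in> edges r p \<longleftrightarrow> i \<in> {1..r} \<and> j = 1"
  by (auto simp: edges_def doubleton_eq_iff)

lemma Arm_Arm_edge: "{Arm i j, Arm i' j'} \<in> edges r p \<longleftrightarrow> i' = i \<and> i \<in> {1..r} \<and>
    (j' = Suc j \<and> 1 \<le> j \<and> j < p i \<or> j = Suc j' \<and> 1 \<le> j' \<and> j' < p i)"
  by (auto simp: edges_def doubleton_eq_iff)

text \<open>At the outer end \<open>j = p i\<close> the vertex \<open>Arm i (Suc j)\<close> lies
  outside the diagram, so no \<open>b\<close> in \<open>V\<close> meets the last case and the
  formula stays uniform.\<close>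

lemma gram_Arm:
  assumes "Arm i j \<in> V" "b \<in> V"
  shows "gram r p (Arm i j) b = (if b = Arm i j then 2 else 0)
    - (if b = node i (j - 1) then 1 else 0) - (if b = Arm i (Suc j) then 1 else 0)"
  using assms
  by (cases b) (auto simp: gram_def node_def Arm_Arm_edge Centre_Arm_edge insert_commute[of _ Centre])

lemma gram_Centre:
  assumes "b \<in> V"
  shows "gram r p Centre b = (if b = Centre then 2 else 0) - (\<Sum>i=1..r. if b = Arm i 1 then 1 else 0)"
proof (cases b)
  case (Arm i j)
  then show ?thesis
    using assms by (cases "j = 1") (simp_all add: gram_def Centre_Arm_edge)
qed (simp add: gram_def)

lemma space_outside: "v \<in> E \<Longrightarrow> x \<notin> V \<Longrightarrow> v x = 0"
  by (simp add: space_def)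

text \<open>This also covers \<open>a\<close> outside \<open>V\<close>, where both sides vanish.
  That absorbs the missing outer neighbour at the end of an arm.\<close>

lemma sum_vertices_delta:
  "v \<in> E \<Longrightarrow> (\<Sum>b\<in>V. v b * (if b = a then m else 0)) = v a * m"
  by (cases "a \<in> V") (auto simp: space_outside if_distrib cong: if_cong)

lemma form_Arm:
  assumes "Arm i j \<in> V" "v \<in> E"
  shows "form' (simple_root (Arm i j)) v = 2 * v (Arm i j) - v (node i (j - 1)) - v (Arm i (Suc j))"
proof -
  have "form' (simple_root (Arm i j)) v = (\<Sum>b\<in>V. v b * (if b = Arm i j then 2 else 0)
     - v b * (if b = node i (j - 1) then 1 else 0) - v b * (if b = Arm i (Suc j) then 1 else 0))"
    unfolding form_simple_root[OF assms(1)]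
    by (intro sum.cong refl) (simp add: gram_Arm[OF assms(1)])
  then show ?thesis
    by (simp only: sum_subtractf sum_vertices_delta[OF assms(2)])
qed

lemma form_Centre:
  assumes "v \<in> E"
  shows "form' (simple_root Centre) v = 2 * v Centre - (\<Sum>i=1..r. v (Arm i 1))"
proof -
  have "form' (simple_root Centre) v = (\<Sum>b\<in>V. v b * (if b = Centre then 2 else 0)
     - (\<Sum>i=1..r. v b * (if b = Arm i 1 then 1 else 0)))"
    unfolding form_simple_root[OF Centre_in_vertices]
    by (intro sum.cong refl) (simp add: gram_Centre sum_distrib_left right_diff_distrib)
  also have "\<dots> = 2 * v Centre - (\<Sum>i=1..r. \<Sum>b\<in>V. v b * (if b = Arm i 1 then 1 else 0))"
    by (simp only: sum_subtractf sum_vertices_delta[OF assms] sum.swap[of _ "{1..r}"])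
  finally show ?thesis
    by (simp only: sum_vertices_delta[OF assms] mult_1_right)
qed

lemma form_expand: "form' u v = (\<Sum>a\<in>V. u a * form' (simple_root a) v)"
  by (simp add: form_def[of r p u] form_simple_root sum_distrib_left mult.assoc)

text \<open>Expand the left argument in simple roots and apply \<open>sum_chain_squares\<close> to
  each arm. The products of \<open>v Centre\<close> with the first coordinate of each arm cancel
  against those in the contribution of the centre.\<close>

lemma form_self:
  assumes v: "v \<in> E"
  shows "form' v v = 2 * (v Centre)\<^sup>2
    + (\<Sum>i=1..r. (\<Sum>j\<le>p i. (v (node i j) - v (node i (Suc j)))\<^sup>2) - (v Centre)\<^sup>2)"
proof -
  have arm: "(\<Sum>j=1..p i. v (Arm i j) * form' (simple_root (Arm i j)) v)
      = (\<Sum>j\<le>p i. (v (node i j) - v (node i (Suc j)))\<^sup>2) - (v Centre)\<^sup>2 + v Centre * v (Arm i 1)"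
    if i: "i \<in> {1..r}" for i
  proof -
    \<comment> \<open>The coordinate just beyond the arm is 0, which removes the two outer boundary
      terms of \<open>sum_chain_squares\<close>.\<close>
    have "v (node i (Suc (p i))) = 0"
      by (rule space_outside[OF v]) (simp add: node_def)
    moreover have "(\<Sum>j=1..p i. v (Arm i j) * form' (simple_root (Arm i j)) v)
      = (\<Sum>j=1..p i. v (node i j) * (2 * v (node i j) - v (node i (j - 1)) - v (node i (Suc j))))"
      using i by (intro sum.cong refl) (simp add: form_Arm[OF _ v], simp add: node_def)
    moreover have "v (node i 0) = v Centre" "v (node i 1) = v (Arm i 1)"
      by (simp_all add: node_def)
    ultimately show ?thesis
      by (simp only: sum_chain_squares[of "\<lambda>j. v (node i j)"]) simp
  qed
  have "form' v v = v Centre * (2 * v Centre - (\<Sum>i=1..r. v (Arm i 1)))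
      + (\<Sum>i=1..r. (\<Sum>j\<le>p i. (v (node i j) - v (node i (Suc j)))\<^sup>2) - (v Centre)\<^sup>2
           + v Centre * v (Arm i 1))"
    unfolding form_expand[of v] sum_vertices form_Centre[OF v]
    by (intro arg_cong2[where f = "(+)"] sum.cong refl) (rule arm)
  then show ?thesis
    by (simp add: sum.distrib flip: sum_distrib_left) (simp add: power2_eq_square right_diff_distrib)
qed

lemma norm_two_level_one_stair:
  assumes v: "v \<in> root_lattice" and level: "v Centre = 1" and norm: "form' v v = 2"
  shows "\<exists>k. (\<forall>i\<in>{1..r}. k i \<le> p i) \<and> v = stair r k"
proof -
  have vE: "v \<in> E" and int: "v x \<in> \<int>" for x using v by (auto simp: root_lattice_def)
  define d where "d i j = v (node i j) - v (node i (Suc j))" for i j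
  have d_int: "d i j \<in> \<int>" for i j by (simp add: d_def int)
  have end0: "v (node i (Suc (p i))) = 0" for i
    by (rule space_outside[OF vE]) (simp add: node_def)
  have sum_d: "(\<Sum>j\<le>p i. d i j) = 1" for i
    using sum_telescope[of "\<lambda>j. v (node i j)" "p i"] end0 by (simp add: d_def node_def level)
  \<comment> \<open>In \<open>form_self\<close> each arm subtracts
    \<open>(v Centre)\<^sup>2 = 1\<close>, which is also the sum of its differences, so norm 2
    leaves exactly this sum of non-negative terms.\<close>
  have "(\<Sum>i=1..r. \<Sum>j\<le>p i. (d i j)\<^sup>2 - d i j) = 0"
    using form_self[OF vE] by (simp add: norm level sum_subtractf sum_d flip: d_def)
  then have "\<forall>i\<in>{1..r}. (\<Sum>j\<le>p i. (d i j)\<^sup>2 - d i j) = 0"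
    by (subst (asm) sum_nonneg_eq_0_iff) (auto intro!: sum_nonneg Ints_square_minus_self_nonneg(1) simp only: finite_atLeastAtMost d_int)
  then have "\<forall>i\<in>{1..r}. \<forall>j\<in>{..p i}. (d i j)\<^sup>2 - d i j = 0"
    using Ints_square_minus_self_nonneg(1)[OF d_int] by (simp add: sum_nonneg_eq_0_iff)
  then have d01: "d i j \<in> {0, 1}" if "i \<in> {1..r}" "j \<le> p i" for i j
    using that Ints_square_minus_self_nonneg(2)[OF d_int[of i j]] by auto
  have "\<exists>k\<le>p i. \<forall>j\<le>Suc (p i). v (node i j) = (if j \<le> k then 1 else 0)" if "i \<in> {1..r}" for i
    using d01[OF that] end0 level by (intro integral_steps_stair) (auto simp: d_def node_def)
  then obtain k where k: "\<And>i. i \<in> {1..r} \<Longrightarrow> k i \<le> p i"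
    "\<And>i j. i \<in> {1..r} \<Longrightarrow> j \<le> Suc (p i) \<Longrightarrow> v (node i j) = (if j \<le> k i then 1 else 0)"
    by metis
  have "v x = stair r k x" for x
  proof (cases x)
    case (Arm i j)
    show ?thesis
    proof (cases "Arm i j \<in> V")
      case True
      then show ?thesis using k(2)[of i j] by (auto simp: Arm node_def)
    next
      case False
      then show ?thesis using space_outside[OF vE False] k(1)[of i] by (auto simp: Arm)
    qed
  qed (simp add: level)
  with k(1) show ?thesis by blast
qed

subsection \<open>Roots and reflections\<close>

lemma reflection_apply: "v \<in> E \<Longrightarrow> refl' \<alpha> v = (\<lambda>x. v x - form' \<alpha> v * \<alpha> x)"
  by (simp add: reflection_def)

lemma space_diff: "u \<in> E \<Longrightarrow> v \<in> E \<Longrightarrow> (\<lambda>x. u x - c * v x) \<in> E"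
  by (simp add: space_def)

lemma form_diff_right: "form' v (\<lambda>x. u x - c * u' x) = form' v u - c * form' v u'"
  using form_add_right[of v u "- c" u'] by simp

lemma form_diff_left: "form' (\<lambda>x. u x - c * u' x) v = form' u v - c * form' u' v"
  using form_add_left[of u "- c" u' v] by simp

lemma reflection_closed: "\<alpha> \<in> E \<Longrightarrow> v \<in> E \<Longrightarrow> refl' \<alpha> v \<in> E"
  by (simp add: reflection_apply space_diff)

lemma reflection_reflection:
  assumes "\<alpha> \<in> E" "form' \<alpha> \<alpha> = 2" "v \<in> E"
  shows "refl' \<alpha> (refl' \<alpha> v) = v"
  using assms by (simp add: reflection_apply space_diff form_diff_right)

lemma reflection_Bij:
  assumes "\<alpha> \<in> E" "form' \<alpha> \<alpha> = 2"
  shows "refl' \<alpha> \<in> Bij E"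
proof -
  have "bij_betw (refl' \<alpha>) E E"
    by (rule bij_betw_byWitness[where f' = "refl' \<alpha>"])
      (use assms in \<open>auto simp: reflection_reflection reflection_closed\<close>)
  then show ?thesis by (simp add: Bij_def reflection_def)
qed

lemma reflection_uminus: "refl' (\<lambda>x. - \<alpha> x) = refl' \<alpha>"
  by (simp add: reflection_def form_uminus_left)

lemma root_lattice_in_space: "v \<in> root_lattice \<Longrightarrow> v \<in> E"
  by (simp add: root_lattice_def)

lemma form_Ints: "u \<in> root_lattice \<Longrightarrow> v \<in> root_lattice \<Longrightarrow> form' u v \<in> \<int>"
  unfolding form_def by (intro Ints_sum Ints_mult) (auto simp: root_lattice_def gram_def)

lemma simple_root_lattice: "a \<in> V \<Longrightarrow> simple_root a \<in> root_lattice"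
  by (auto simp: root_lattice_def simple_root_def space_def)

lemma form_simple_root_self: "a \<in> V \<Longrightarrow> form' (simple_root a) (simple_root a) = 2"
proof -
  assume a: "a \<in> V"
  have "form' (simple_root a) (simple_root a) = (\<Sum>b\<in>V. if b = a then gram r p a a else 0)"
    unfolding form_simple_root[OF a] by (intro sum.cong) (auto simp: simple_root_def)
  with a show ?thesis by (simp add: gram_def)
qed

lemma simple_reflection_Bij: "a \<in> V \<Longrightarrow> refl' (simple_root a) \<in> Bij E"
  by (simp add: reflection_Bij root_lattice_in_space simple_root_lattice form_simple_root_self)

text \<open>The invariants carried from the simple reflections to all of \<open>W\<close>. Linearity
  is phrased with \<open>u - c * v\<close> because this is the shape of a reflected vector.\<close>

definition lattice_isometry :: "((vertex \<Rightarrow> real) \<Rightarrow> vertex \<Rightarrow> real) \<Rightarrow> bool" where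
  "lattice_isometry w \<longleftrightarrow>
     (\<forall>u\<in>E. \<forall>v\<in>E. \<forall>c. w (\<lambda>x. u x - c * v x) = (\<lambda>x. w u x - c * w v x)) \<and>
     (\<forall>u\<in>E. \<forall>v\<in>E. form' (w u) (w v) = form' u v) \<and>
     w ` E \<subseteq> E \<and> w ` root_lattice \<subseteq> root_lattice"

lemma lattice_isometryI:
  assumes "\<And>u v c. u \<in> E \<Longrightarrow> v \<in> E \<Longrightarrow> w (\<lambda>x. u x - c * v x) = (\<lambda>x. w u x - c * w v x)"
    and "\<And>u v. u \<in> E \<Longrightarrow> v \<in> E \<Longrightarrow> form' (w u) (w v) = form' u v"
    and "\<And>v. v \<in> E \<Longrightarrow> w v \<in> E"
    and "\<And>v. v \<in> root_lattice \<Longrightarrow> w v \<in> root_lattice"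
  shows "lattice_isometry w"
  unfolding lattice_isometry_def image_subset_iff by (intro conjI ballI allI assms)

lemma lattice_isometryD:
  assumes "lattice_isometry w"
  shows "u \<in> E \<Longrightarrow> v \<in> E \<Longrightarrow> w (\<lambda>x. u x - c * v x) = (\<lambda>x. w u x - c * w v x)"
    and "u \<in> E \<Longrightarrow> v \<in> E \<Longrightarrow> form' (w u) (w v) = form' u v"
    and "v \<in> E \<Longrightarrow> w v \<in> E"
    and "v \<in> root_lattice \<Longrightarrow> w v \<in> root_lattice"
  by (fact assms[unfolded lattice_isometry_def image_subset_iff, THEN conjunct1, rule_format]
      assms[unfolded lattice_isometry_def image_subset_iff, THEN conjunct2, THEN conjunct1, rule_format]
      assms[unfolded lattice_isometry_def image_subset_iff, THEN conjunct2, THEN conjunct2,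
        THEN conjunct1, rule_format]
      assms[unfolded lattice_isometry_def image_subset_iff, THEN conjunct2, THEN conjunct2,
        THEN conjunct2, rule_format])+

lemma lattice_isometry_reflection:
  assumes "\<alpha> \<in> root_lattice" "form' \<alpha> \<alpha> = 2"
  shows "lattice_isometry (refl' \<alpha>)"
proof -
  have \<alpha>: "\<alpha> \<in> E" using assms(1) by (rule root_lattice_in_space)
  show ?thesis
  proof (rule lattice_isometryI)
    fix u v c assume uv: "u \<in> E" "v \<in> E"
    show "refl' \<alpha> (\<lambda>x. u x - c * v x) = (\<lambda>x. refl' \<alpha> u x - c * refl' \<alpha> v x)"
      using uv by (simp add: reflection_apply space_diff form_diff_right algebra_simps)
  next
    fix u v assume uv: "u \<in> E" "v \<in> E"
    show "form' (refl' \<alpha> u) (refl' \<alpha> v) = form' u v"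
      using uv assms(2) form_sym[of u \<alpha>]
      by (simp add: reflection_apply form_diff_right form_diff_left)
  next
    \<comment> \<open>A reflection changes \<open>v\<close> by an integral multiple of the lattice
      vector \<alpha>, since the form is integral on the lattice.\<close>
    fix v assume v: "v \<in> root_lattice"
    then show "refl' \<alpha> v \<in> root_lattice"
      using assms(1) form_Ints[OF assms(1) v]
      by (simp add: reflection_apply root_lattice_in_space) (simp add: root_lattice_def space_def)
  qed (simp add: reflection_closed \<alpha>)
qed

lemma lattice_isometry_compose:
  assumes "lattice_isometry w" "lattice_isometry w'"
  shows "lattice_isometry (compose E w w')"
  by (rule lattice_isometryI)
    (simp_all add: compose_eq space_diff root_lattice_in_space
      lattice_isometryD[OF assms(1)] lattice_isometryD[OF assms(2)])

lemma lattice_isometry_id: "lattice_isometry (\<lambda>v\<in>E. v)"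
  by (rule lattice_isometryI) (simp_all add: space_diff root_lattice_in_space)

section \<open>The group generated by the simple reflections\<close>

lemma S_bar_Bij: "S_bar r p \<subseteq> carrier (BijGroup E)"
  by (auto simp: S_bar_def BijGroup_def simple_reflection_Bij)

lemma subgroup_W: "subgroup (carrier W) (BijGroup E)"
  using group.generate_is_subgroup[OF group_BijGroup S_bar_Bij] by (simp add: W_bar_def)

lemma W_eq: "W = (BijGroup E)\<lparr>carrier := carrier W\<rparr>"
  by (simp add: W_bar_def)

lemma group_W: "group W"
  by (subst W_eq) (rule subgroup.subgroup_is_group[OF subgroup_W group_BijGroup])

lemma one_W: "\<one>\<^bsub>W\<^esub> = (\<lambda>v\<in>E. v)"
  by (simp add: W_bar_def BijGroup_def)

lemma W_Bij: "w \<in> carrier W \<Longrightarrow> w \<in> Bij E"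
  using subgroup.subset[OF subgroup_W] by (auto simp: BijGroup_def)

lemma mult_W: "w \<in> carrier W \<Longrightarrow> w' \<in> carrier W \<Longrightarrow> w \<otimes>\<^bsub>W\<^esub> w' = compose E w w'"
  using W_Bij[of w] W_Bij[of w'] by (subst W_eq) (simp add: BijGroup_def)

lemma mult_W_apply:
  "w \<in> carrier W \<Longrightarrow> w' \<in> carrier W \<Longrightarrow> v \<in> E \<Longrightarrow> (w \<otimes>\<^bsub>W\<^esub> w') v = w (w' v)"
  by (simp add: mult_W compose_def)

lemma simple_reflection_W: "a \<in> V \<Longrightarrow> refl' (simple_root a) \<in> carrier W"
  by (auto simp: W_bar_def S_bar_def intro: generate.incl)

lemma reflection_square_W:
  assumes "refl' \<alpha> \<in> carrier W" "\<alpha> \<in> E" "form' \<alpha> \<alpha> = 2"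
  shows "refl' \<alpha> \<otimes>\<^bsub>W\<^esub> refl' \<alpha> = \<one>\<^bsub>W\<^esub>"
  using assms by (auto simp: mult_W one_W compose_def reflection_reflection)

lemma simple_reflection_square_W:
  "a \<in> V \<Longrightarrow> refl' (simple_root a) \<otimes>\<^bsub>W\<^esub> refl' (simple_root a) = \<one>\<^bsub>W\<^esub>"
  by (simp add: reflection_square_W simple_reflection_W root_lattice_in_space simple_root_lattice
      form_simple_root_self)

lemma S_bar_W: "S_bar r p \<subseteq> carrier W"
  by (auto simp: S_bar_def simple_reflection_W)

text \<open>The carrier is defined by generation inside \<open>BijGroup E\<close>; restating it
  inside \<open>W\<close> makes induction available with the operations of \<open>W\<close>
  itself.\<close>

lemma W_generate: "carrier W = generate W (S_bar r p)"
proof -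
  have "generate W (S_bar r p) = generate (BijGroup E) (S_bar r p)"
    by (subst W_eq) (rule group.generate_consistent[OF group_BijGroup S_bar_W subgroup_W])
  then show ?thesis by (simp add: W_bar_def)
qed

lemma lattice_isometry_W:
  assumes "w \<in> carrier W"
  shows "lattice_isometry w"
proof -
  interpret group W by (rule group_W)
  have "w \<in> generate W (S_bar r p)"
    using assms by (subst (asm) W_generate)
  then show ?thesis
  proof (rule generate_involutions_induct[OF _ S_bar_W])
    show "lattice_isometry \<one>\<^bsub>W\<^esub>"
      by (simp add: one_W lattice_isometry_id)
  next
    fix s assume "s \<in> S_bar r p"
    then obtain a where a: "a \<in> V" "s = refl' (simple_root a)" by (auto simp: S_bar_def)
    show "s \<otimes>\<^bsub>W\<^esub> s = \<one>\<^bsub>W\<^esub>"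
      unfolding a(2) by (rule simple_reflection_square_W[OF a(1)])
    show "lattice_isometry s"
      unfolding a(2)
      by (rule lattice_isometry_reflection[OF simple_root_lattice[OF a(1)] form_simple_root_self[OF a(1)]])
  next
    fix x y
    assume "x \<in> generate W (S_bar r p)" "y \<in> generate W (S_bar r p)"
      and iso: "lattice_isometry x" "lattice_isometry y"
    then have "x \<in> carrier W" "y \<in> carrier W" by (auto intro: generate_in_carrier[OF S_bar_W])
    then show "lattice_isometry (x \<otimes>\<^bsub>W\<^esub> y)"
      by (simp add: mult_W lattice_isometry_compose[OF iso])
  qed
qed

lemmas W_diff = lattice_isometryD(1)[OF lattice_isometry_W]
  and W_form = lattice_isometryD(2)[OF lattice_isometry_W]
  and W_space = lattice_isometryD(3)[OF lattice_isometry_W]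
  and W_lattice = lattice_isometryD(4)[OF lattice_isometry_W]

lemma inv_W_apply:
  assumes "w \<in> carrier W" "v \<in> E"
  shows "(inv\<^bsub>W\<^esub> w) (w v) = v" and "w ((inv\<^bsub>W\<^esub> w) v) = v"
proof -
  interpret group W by (rule group_W)
  show "(inv\<^bsub>W\<^esub> w) (w v) = v" "w ((inv\<^bsub>W\<^esub> w) v) = v"
    using mult_W_apply[of "inv\<^bsub>W\<^esub> w" w v] mult_W_apply[of w "inv\<^bsub>W\<^esub> w" v] assms
    by (simp_all add: one_W)
qed

text \<open>With \<open>u\<close> the preimage of \<open>v\<close> under \<open>w\<close>, linearity
  and invariance of the form turn the image under \<open>w\<close> of the reflected \<open>u\<close>
  into the reflection of \<open>v\<close> in \<open>w \<alpha>\<close>. Both sides are extensional,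
  so agreement on \<open>E\<close> suffices.\<close>

lemma conj_reflection:
  assumes w: "w \<in> carrier W" and \<alpha>: "\<alpha> \<in> E" "refl' \<alpha> \<in> carrier W"
  shows "w \<otimes>\<^bsub>W\<^esub> refl' \<alpha> \<otimes>\<^bsub>W\<^esub> inv\<^bsub>W\<^esub> w = refl' (w \<alpha>)"
proof -
  interpret group W by (rule group_W)
  have "(w \<otimes>\<^bsub>W\<^esub> refl' \<alpha> \<otimes>\<^bsub>W\<^esub> inv\<^bsub>W\<^esub> w) v = refl' (w \<alpha>) v" if v: "v \<in> E" for v
  proof -
    define u where "u = (inv\<^bsub>W\<^esub> w) v"
    have u: "u \<in> E" "v = w u"
      using w v by (simp_all add: u_def W_space inv_W_apply)
    have "(w \<otimes>\<^bsub>W\<^esub> refl' \<alpha> \<otimes>\<^bsub>W\<^esub> inv\<^bsub>W\<^esub> w) v = w (refl' \<alpha> u)"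
      using w \<alpha> v u(1) by (simp add: mult_W_apply flip: u_def)
    also have "\<dots> = refl' (w \<alpha>) (w u)"
      using w \<alpha> u by (simp add: reflection_apply W_diff W_form W_space)
    finally show ?thesis using u by simp
  qed
  moreover have "w \<otimes>\<^bsub>W\<^esub> refl' \<alpha> \<otimes>\<^bsub>W\<^esub> inv\<^bsub>W\<^esub> w \<in> extensional E"
    using w \<alpha> by (intro Bij_imp_extensional W_Bij) simp
  ultimately show ?thesis
    by (intro extensionalityI[of _ E]) (auto simp: reflection_def)
qed

section \<open>Roots and the reflections they define\<close>

lemma root_lattice_Phi: "\<beta> \<in> Phi_bar r p \<Longrightarrow> \<beta> \<in> root_lattice"
  by (auto simp: Phi_bar_def W_lattice simple_root_lattice)

lemma form_Phi: "\<beta> \<in> Phi_bar r p \<Longrightarrow> form' \<beta> \<beta> = 2"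
  by (auto simp: Phi_bar_def W_form simple_root_lattice root_lattice_in_space form_simple_root_self)

lemma Phi_closed:
  assumes "w \<in> carrier W" "\<beta> \<in> Phi_bar r p"
  shows "w \<beta> \<in> Phi_bar r p"
proof -
  interpret group W by (rule group_W)
  obtain u a where ua: "\<beta> = u (simple_root a)" "u \<in> carrier W" "a \<in> V"
    using assms(2) by (auto simp: Phi_bar_def)
  then have "w \<beta> = (w \<otimes>\<^bsub>W\<^esub> u) (simple_root a)"
    using assms(1) by (simp add: mult_W_apply root_lattice_in_space simple_root_lattice)
  then show ?thesis
    using ua assms(1) m_closed unfolding Phi_bar_def by blast
qed

text \<open>By \<open>conj_reflection\<close>, conjugating a simple reflection by \<open>w\<close>
  amounts to moving its root by \<open>w\<close>.\<close>

lemma T_bar_eq: "T_bar r p = refl' ` Phi_bar r p"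
proof -
  have "T_bar r p = {w \<otimes>\<^bsub>W\<^esub> refl' (simple_root a) \<otimes>\<^bsub>W\<^esub> inv\<^bsub>W\<^esub> w | w a. w \<in> carrier W \<and> a \<in> V}"
    unfolding T_bar_def S_bar_def by blast
  also have "\<dots> = {refl' (w (simple_root a)) | w a. w \<in> carrier W \<and> a \<in> V}"
    by (intro Collect_cong ex_cong1)
      (auto simp: conj_reflection simple_reflection_W root_lattice_in_space simple_root_lattice)
  also have "\<dots> = refl' ` Phi_bar r p"
    unfolding Phi_bar_def by blast
  finally show ?thesis .
qed

lemma T_bar_W: "T_bar r p \<subseteq> carrier W"
proof -
  interpret group W by (rule group_W)
  show ?thesis
    using S_bar_W by (auto simp: T_bar_def subset_iff)
qed

text \<open>The reflection in \<beta> belongs to \<open>W\<close> and negates \<beta>.\<close>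

lemma uminus_Phi:
  assumes "\<beta> \<in> Phi_bar r p"
  shows "(\<lambda>x. - \<beta> x) \<in> Phi_bar r p"
proof -
  have "refl' \<beta> \<in> carrier W" using T_bar_W assms by (auto simp: T_bar_eq)
  moreover have "refl' \<beta> \<beta> = (\<lambda>x. - \<beta> x)"
    using assms by (simp add: reflection_apply root_lattice_in_space root_lattice_Phi form_Phi)
  ultimately show ?thesis using Phi_closed[OF _ assms] by metis
qed

text \<open>Roots are integral, so once the coordinate at the centre is 1 the remaining coordinates
  are the coefficients of an element of \<Lambda>.\<close>

lemma level_one_roots_eq: "level_one_roots r p = {\<beta> \<in> Phi_bar r p. \<beta> Centre = 1}"
proof -
  have lin: "(\<Sum>a\<in>arm_vertices r p. of_int (c a) * simple_root a x)
      = (if x \<in> arm_vertices r p then of_int (c x) else 0 :: real)" for c x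
    by (simp add: simple_root_def if_distrib cong: if_cong)
  have "\<exists>l\<in>arm_lattice r p. \<beta> = (\<lambda>x. simple_root Centre x + l x)"
    if "\<beta> \<in> root_lattice" "\<beta> Centre = 1" for \<beta>
  proof -
    \<comment> \<open>The floor only converts the integral real coordinates to type
      \<open>int\<close>.\<close>
    define c where "c x = \<lfloor>\<beta> x\<rfloor>" for x
    have "\<beta> x = of_int (c x)" for x
      using that by (auto simp: c_def root_lattice_def elim!: Ints_cases)
    then have "\<beta> = (\<lambda>x. simple_root Centre x + (\<Sum>a\<in>arm_vertices r p. of_int (c a) * simple_root a x))"
      using that(2) space_outside[OF root_lattice_in_space[OF that(1)]]
      unfolding lin by (intro ext) (auto simp: simple_root_def vertices_def)
    then show ?thesis
      by (intro bexI[of _ "\<lambda>x. \<Sum>a\<in>arm_vertices r p. of_int (c a) * simple_root a x"])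
        (auto simp: arm_lattice_def)
  qed
  moreover have "l Centre = 0" if "l \<in> arm_lattice r p" for l
    using that by (auto simp: arm_lattice_def lin)
  ultimately show ?thesis
    unfolding level_one_roots_def using root_lattice_Phi by (auto simp: simple_root_def)
qed

subsection \<open>The parabolic subgroup\<close>

abbreviation "P \<equiv> P_set r p"

lemma arm_reflections_W: "(\<lambda>a. refl' (simple_root a)) ` arm_vertices r p \<subseteq> carrier W"
  using arm_subset_vertices by (auto intro: simple_reflection_W)

lemma subgroup_P: "subgroup P W"
  unfolding P_set_def by (rule group.generate_is_subgroup[OF group_W arm_reflections_W])

lemma P_W: "w \<in> P \<Longrightarrow> w \<in> carrier W"
  using subgroup.subset[OF subgroup_P] by blast

lemma group_P: "group (P_group r p)"
  unfolding P_group_def by (rule subgroup.subgroup_is_group[OF subgroup_P group_W])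

lemma carrier_P: "carrier (P_group r p) = P"
  and mult_P: "mult (P_group r p) = mult W"
  and one_P: "\<one>\<^bsub>P_group r p\<^esub> = \<one>\<^bsub>W\<^esub>"
  by (simp_all add: P_group_def)

lemma simple_reflection_P: "a \<in> arm_vertices r p \<Longrightarrow> refl' (simple_root a) \<in> P"
  unfolding P_set_def by (rule generate.incl) simp

text \<open>A generator of \<open>P\<close> subtracts a multiple of a simple root on an arm, whose
  coordinate at the centre is 0.\<close>

lemma P_Centre:
  assumes "w \<in> P" "v \<in> E"
  shows "w v Centre = v Centre"
proof -
  interpret group W by (rule group_W)
  let ?A = "(\<lambda>a. refl' (simple_root a)) ` arm_vertices r p"
  have "w \<in> generate W ?A"
    using assms(1) by (simp add: P_set_def)
  then have "\<forall>v\<in>E. w v Centre = v Centre"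
  proof (rule generate_involutions_induct[OF _ arm_reflections_W])
    fix s assume "s \<in> ?A"
    then obtain a where a: "a \<in> arm_vertices r p" "s = refl' (simple_root a)" by blast
    then have aV: "a \<in> V" using arm_subset_vertices by blast
    show "s \<otimes>\<^bsub>W\<^esub> s = \<one>\<^bsub>W\<^esub>"
      unfolding a(2) by (rule simple_reflection_square_W[OF aV])
    show "\<forall>v\<in>E. s v Centre = v Centre"
      using a Centre_notin_arm by (auto simp: reflection_apply simple_root_def)
  next
    fix x y
    assume "x \<in> generate W ?A" "y \<in> generate W ?A"
      and fix_Centre: "\<forall>v\<in>E. x v Centre = v Centre" "\<forall>v\<in>E. y v Centre = v Centre"
    then have "x \<in> carrier W" "y \<in> carrier W" by (auto intro: generate_in_carrier[OF arm_reflections_W])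
    then show "\<forall>v\<in>E. (x \<otimes>\<^bsub>W\<^esub> y) v Centre = v Centre"
      using fix_Centre by (simp add: mult_W_apply W_space)
  qed (simp add: one_W)
  with assms(2) show ?thesis by blast
qed

section \<open>Transitivity on the roots of level one\<close>

lemma stair_space: "\<forall>i\<in>{1..r}. k i \<le> p i \<Longrightarrow> stair r k \<in> E"
  by (force simp: space_def stair_def vertices_def arm_vertices_def split: vertex.splits)

text \<open>The last vertex of a segment has inner neighbour value 1 and outer neighbour value 0, so
  its simple root pairs with the stair to 2 - 1 - 0 = 1 and is subtracted once.\<close>

lemma reflection_stair:
  assumes k: "\<forall>i\<in>{1..r}. k i \<le> p i" and i: "i \<in> {1..r}" "k i = Suc n"
  shows "refl' (simple_root (Arm i (Suc n))) (stair r k) = stair r (k(i := n))"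
proof -
  have "Arm i (Suc n) \<in> V" using k i by force
  then have "form' (simple_root (Arm i (Suc n))) (stair r k) = 1"
    using i by (simp add: form_Arm stair_space[OF k] node_def)
  then show ?thesis
    using i by (auto simp: fun_eq_iff reflection_apply stair_space[OF k] simple_root_def stair_def
        split: vertex.splits)
qed

text \<open>Induction on the total length of the segments: one reflection shortens a nonempty
  segment, and length 0 leaves \<alpha>\<open>\<^sub>1\<close>.\<close>

lemma stair_to_Centre:
  assumes "\<forall>i\<in>{1..r}. k i \<le> p i"
  shows "\<exists>w\<in>P. w (stair r k) = simple_root Centre"
  using assms
proof (induction "\<Sum>i=1..r. k i" arbitrary: k rule: less_induct)
  case less
  interpret P: subgroup P W by (rule subgroup_P)
  show ?case
  proof (cases "\<exists>i\<in>{1..r}. k i \<noteq> 0")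
    case True
    then obtain i n where i: "i \<in> {1..r}" "k i = Suc n" using not0_implies_Suc by blast
    have smaller: "(\<Sum>j=1..r. (k(i := n)) j) < (\<Sum>j=1..r. k j)"
      using i by (intro sum_strict_mono_ex1) auto
    have bound: "\<forall>j\<in>{1..r}. (k(i := n)) j \<le> p j"
      using less.prems i by force
    obtain w where w: "w \<in> P" "w (stair r (k(i := n))) = simple_root Centre"
      using less.hyps[OF smaller bound] by blast
    have s: "refl' (simple_root (Arm i (Suc n))) \<in> P"
      using less.prems i by (intro simple_reflection_P) (force simp: arm_vertices_def)
    show ?thesis
    proof (rule bexI)
      show "(w \<otimes>\<^bsub>W\<^esub> refl' (simple_root (Arm i (Suc n)))) (stair r k) = simple_root Centre"
        using w s less.prems i by (simp add: mult_W_apply P_W stair_space reflection_stair)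
    qed (use w s in blast)
  next
    case False
    then have "stair r k = simple_root Centre"
      by (auto simp: fun_eq_iff stair_def simple_root_def split: vertex.splits)
    moreover have "simple_root Centre \<in> E"
      by (simp add: simple_root_lattice root_lattice_in_space)
    ultimately show ?thesis
      by (intro bexI[of _ "\<one>\<^bsub>W\<^esub>"]) (simp_all add: one_W[symmetric], simp add: one_W)
  qed
qed

lemma level_one_to_Centre:
  assumes "\<beta> \<in> level_one_roots r p"
  shows "\<exists>w\<in>P. w \<beta> = simple_root Centre"
proof -
  have "\<beta> \<in> Phi_bar r p" "\<beta> Centre = 1"
    using assms by (auto simp: level_one_roots_eq)
  then show ?thesis
    using norm_two_level_one_stair[OF root_lattice_Phi _ form_Phi] stair_to_Centre by blast
qed

lemma level_one_space: "\<beta> \<in> level_one_roots r p \<Longrightarrow> \<beta> \<in> E"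
  by (simp add: level_one_roots_eq root_lattice_in_space root_lattice_Phi)

lemma level_one_transitive:
  assumes "\<beta> \<in> level_one_roots r p" "\<gamma> \<in> level_one_roots r p"
  shows "\<exists>w\<in>P. w \<beta> = \<gamma>"
proof -
  interpret group W by (rule group_W)
  obtain u v where u: "u \<in> P" "u \<beta> = simple_root Centre" and v: "v \<in> P" "v \<gamma> = simple_root Centre"
    using assms level_one_to_Centre by metis
  show ?thesis
  proof (rule bexI)
    \<comment> \<open>The path from \<beta> to \<gamma> runs through
      \<alpha>\<open>\<^sub>1\<close>.\<close>
    show "(inv\<^bsub>W\<^esub> v \<otimes>\<^bsub>W\<^esub> u) \<beta> = \<gamma>"
      using assms u v inv_W_apply(1)[of v \<gamma>] by (simp add: mult_W_apply P_W level_one_space)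
    show "inv\<^bsub>W\<^esub> v \<otimes>\<^bsub>W\<^esub> u \<in> P"
      using u v subgroup_P by (simp add: subgroup.m_closed subgroup.m_inv_closed)
  qed
qed

lemma transitive_level_one:
  "transitive_action (P_group r p) (level_one_roots r p) (\<lambda>w. \<lambda>\<beta>\<in>level_one_roots r p. w \<beta>)"
proof (intro transitive_action.intro transitive_action_axioms.intro
    group_action_restrictI[OF group_P, where f = "\<lambda>w. w"])
  \<comment> \<open>By \<open>level_one_roots_eq\<close> it is enough that \<open>P\<close>
    preserves the roots and the coordinate at the centre.\<close>
  show "w \<beta> \<in> level_one_roots r p"
    if "w \<in> carrier (P_group r p)" "\<beta> \<in> level_one_roots r p" for w \<beta>
    using that by (auto simp: carrier_P level_one_roots_eq P_W Phi_closed P_Centre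
        root_lattice_in_space root_lattice_Phi)
  show "\<exists>w\<in>carrier (P_group r p). (\<lambda>\<beta>\<in>level_one_roots r p. w \<beta>) \<beta> = \<gamma>"
    if "\<beta> \<in> level_one_roots r p" "\<gamma> \<in> level_one_roots r p" for \<beta> \<gamma>
    using level_one_transitive[OF that] that by (simp add: carrier_P)
qed (simp_all add: carrier_P one_P mult_P one_W level_one_space mult_W_apply P_W)

section \<open>Reflections that generate \<open>W\<close> together with \<open>P\<close>\<close>

text \<open>\<open>P\<close> fixes the coordinate at the centre, and the reflection in \<beta> adds
  \<open>- form' \<beta> v\<close> times that of \<beta>, an integral multiple. The shifts of
  successive factors add up.\<close>

lemma generate_W_shift:
  assumes t: "refl' \<beta> \<in> carrier W" "\<beta> \<in> root_lattice" "form' \<beta> \<beta> = 2"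
    and w: "w \<in> generate W (insert (refl' \<beta>) P)"
    and v: "v \<in> root_lattice"
  shows "\<exists>n\<in>\<int>. w v Centre = v Centre + n * \<beta> Centre"
proof -
  interpret group W by (rule group_W)
  have gens: "insert (refl' \<beta>) P \<subseteq> carrier W"
    using t(1) P_W by blast
  have gen: "\<exists>n\<in>\<int>. s v Centre = v Centre + n * \<beta> Centre"
    if "s \<in> insert (refl' \<beta>) P" "v \<in> root_lattice" for s v
  proof (cases "s \<in> P")
    case True
    then show ?thesis
      using that by (intro bexI[of _ 0]) (simp_all add: P_Centre root_lattice_in_space)
  next
    case False
    then show ?thesis
      using that t(2) form_Ints[OF t(2), of v]
      by (intro bexI[of _ "- form' \<beta> v"]) (auto simp: reflection_apply root_lattice_in_space)
  qed
  show ?thesis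
    using w v
  proof (induction arbitrary: v rule: generate.induct)
    case one
    then show ?case by (intro bexI[of _ 0]) (simp_all add: one_W root_lattice_in_space)
  next
    case (incl s)
    then show ?case by (rule gen)
  next
    \<comment> \<open>The generating set is closed under inverses: \<open>P\<close> is a subgroup
      and the reflection is an involution.\<close>
    case (inv s)
    have "inv\<^bsub>W\<^esub> (refl' \<beta>) = refl' \<beta>"
      by (rule inv_equality[OF reflection_square_W[OF t(1) root_lattice_in_space[OF t(2)] t(3)] t(1) t(1)])
    moreover have "inv\<^bsub>W\<^esub> s \<in> P" if "s \<in> P"
      using subgroup.m_inv_closed[OF subgroup_P that] .
    ultimately have "inv\<^bsub>W\<^esub> s \<in> insert (refl' \<beta>) P"
      using inv.hyps by auto
    then show ?case using inv.prems by (rule gen)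
  next
    case (eng x y)
    have xy: "x \<in> carrier W" "y \<in> carrier W"
      using eng.hyps generate_in_carrier[OF gens] by blast+
    obtain m where m: "m \<in> \<int>" "y v Centre = v Centre + m * \<beta> Centre"
      using eng.IH(2)[OF eng.prems] by blast
    \<comment> \<open>The hypothesis for \<open>x\<close> is applied to \<open>y v\<close>, which is
      again a lattice vector; hence \<open>v\<close> is arbitrary in the induction.\<close>
    obtain n where n: "n \<in> \<int>" "x (y v) Centre = y v Centre + n * \<beta> Centre"
      using eng.IH(1)[OF W_lattice[OF xy(2) eng.prems]] by blast
    show ?case
    proof (rule bexI)
      show "(x \<otimes>\<^bsub>W\<^esub> y) v Centre = v Centre + (m + n) * \<beta> Centre"
        using m n by (simp add: mult_W_apply[OF xy] root_lattice_in_space[OF eng.prems] algebra_simps)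
    qed (use m n in simp)
  qed
qed

text \<open>Modulo the \<open>Centre\<close> coordinate \<open>m\<close> of \<open>\<beta>\<close>, neither \<open>P\<close> nor the reflection in \<open>\<beta>\<close>
  changes the \<open>Centre\<close> coordinate of a lattice vector, whereas the simple reflection at \<open>Centre\<close>
  turns a neighbouring simple root into a vector of \<open>Centre\<close> coordinate 1. Hence \<open>m\<close> is a unit.\<close>

lemma complementary_Centre:
  assumes arms: "\<forall>i\<in>{1..r}. 1 \<le> p i" and \<beta>: "\<beta> \<in> Phi_bar r p"
    and gen: "carrier W = generate W (insert (refl' \<beta>) P)"
  shows "\<beta> Centre = 1 \<or> \<beta> Centre = - 1"
proof (cases "r = 0")
  \<comment> \<open>Without arms \<open>form_self\<close> reads norm =
    \<open>2 * (\<beta> Centre)\<^sup>2\<close>, and the norm is 2.\<close>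
  case True
  then show ?thesis
    using form_self[OF root_lattice_in_space[OF root_lattice_Phi[OF \<beta>]]] form_Phi[OF \<beta>]
    by (simp add: power2_eq_1_iff)
next
  case False
  \<comment> \<open>As arms are nonempty, the first arm supplies a neighbour of the centre.\<close>
  then have arm: "Arm 1 1 \<in> V" using arms by simp
  have \<beta>_W: "refl' \<beta> \<in> carrier W"
    by (subst gen) (rule generate.incl, simp)
  define v where "v = simple_root (Arm 1 1)"
  have v: "v \<in> root_lattice" "v \<in> E"
    using simple_root_lattice[OF arm] by (simp_all add: v_def root_lattice_in_space)
  have "form' (simple_root Centre) v = - (\<Sum>i=1..r. if i = 1 then 1 else 0)"
    unfolding form_Centre[OF v(2)] by (simp add: v_def simple_root_def)
  also have "\<dots> = - 1" using False by simp
  finally have s_v: "refl' (simple_root Centre) v Centre = 1"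
    by (simp add: reflection_apply[OF v(2)]) (simp add: v_def simple_root_def)
  have v_Centre: "v Centre = 0" by (simp add: v_def simple_root_def)
  have s: "refl' (simple_root Centre) \<in> generate W (insert (refl' \<beta>) P)"
    using simple_reflection_W[OF Centre_in_vertices] by (subst (asm) gen)
  obtain n where n: "n \<in> \<int>" "1 = n * \<beta> Centre"
    using generate_W_shift[OF \<beta>_W root_lattice_Phi[OF \<beta>] form_Phi[OF \<beta>] s v(1)]
    unfolding s_v v_Centre add_0 by blast
  have "\<beta> Centre \<in> \<int>"
    using root_lattice_Phi[OF \<beta>] by (simp add: root_lattice_def)
  then obtain b where b: "\<beta> Centre = of_int b" by (rule Ints_cases)
  obtain a where a: "n = of_int a" using n(1) by (rule Ints_cases)
  have "real_of_int (a * b) = 1" using n(2) a b by simp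
  then have "a * b = 1" by linarith
  then show ?thesis
    by (auto simp: b zmult_eq_1_iff)
qed

text \<open>Opposite roots define the same reflection, so a root with coordinate -1 at the centre
  can be replaced by its negative.\<close>

lemma complementary_level_one:
  assumes arms: "\<forall>i\<in>{1..r}. 1 \<le> p i" and t: "t \<in> complementary_reflections r p"
  shows "\<exists>\<beta>\<in>level_one_roots r p. t = refl' \<beta>"
proof -
  obtain \<beta> where \<beta>: "\<beta> \<in> Phi_bar r p" "t = refl' \<beta>"
    using t by (auto simp: complementary_reflections_def T_bar_eq)
  have "\<beta> Centre = 1 \<or> \<beta> Centre = - 1"
    using t complementary_Centre[OF arms \<beta>(1)] by (simp add: complementary_reflections_def \<beta>(2))
  then show ?thesis
  proof
    assume "\<beta> Centre = 1"
    then show ?thesis using \<beta> by (auto simp: level_one_roots_eq)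
  next
    assume "\<beta> Centre = - 1"
    then have "(\<lambda>x. - \<beta> x) \<in> level_one_roots r p"
      by (simp add: level_one_roots_eq uminus_Phi \<beta>(1))
    then show ?thesis
      unfolding \<beta>(2) by (rule rev_bexI) (simp add: reflection_uminus)
  qed
qed

text \<open>Since \<open>w\<close> lies in \<open>P\<close>, the group generated by \<open>P\<close>
  and the conjugate also contains \<open>t\<close>, hence all of \<open>W\<close>.\<close>

lemma conj_complementary:
  assumes w: "w \<in> P" and t: "t \<in> complementary_reflections r p"
  shows "w \<otimes>\<^bsub>W\<^esub> t \<otimes>\<^bsub>W\<^esub> inv\<^bsub>W\<^esub> w \<in> complementary_reflections r p" (is "?t' \<in> _")
proof -
  interpret group W by (rule group_W)
  have wW: "w \<in> carrier W" by (rule P_W[OF w])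
  have tT: "t \<in> T_bar r p" and gen: "carrier W = generate W (insert t P)"
    using t by (auto simp: complementary_reflections_def)
  have tW: "t \<in> carrier W" using T_bar_W tT by blast
  obtain \<beta> where \<beta>: "\<beta> \<in> Phi_bar r p" "t = refl' \<beta>"
    using tT by (auto simp: T_bar_eq)
  have "?t' = refl' (w \<beta>)"
    unfolding \<beta>(2) using tW \<beta> by (intro conj_reflection wW) (simp_all add: root_lattice_in_space root_lattice_Phi)
  then have t'T: "?t' \<in> T_bar r p"
    using Phi_closed[OF wW \<beta>(1)] by (simp add: T_bar_eq)
  let ?K = "generate W (insert ?t' P)"
  have sub: "insert ?t' P \<subseteq> carrier W"
    using t'T T_bar_W P_W by blast
  interpret K: subgroup ?K W by (rule generate_is_subgroup[OF sub])
  have K: "?t' \<in> ?K" "w \<in> ?K" "P \<subseteq> ?K"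
    using w by (auto intro: generate.incl)
  have "t = inv\<^bsub>W\<^esub> w \<otimes>\<^bsub>W\<^esub> ?t' \<otimes>\<^bsub>W\<^esub> w"
    using wW tW by (simp add: m_assoc) (simp add: inv_solve_left)
  also have "\<dots> \<in> ?K" using K by (meson K.m_closed K.m_inv_closed)
  finally have "generate W (insert t P) \<subseteq> ?K"
    using K by (intro generate_subgroup_incl K.subgroup_axioms) auto
  then have "carrier W = ?K"
    using gen generate_incl[OF sub] by blast
  with t'T show ?thesis
    unfolding complementary_reflections_def by (intro CollectI conjI)
qed

lemma transitive_complementary:
  assumes arms: "\<forall>i\<in>{1..r}. 1 \<le> p i"
  shows "transitive_action (P_group r p) (complementary_reflections r p)
    (\<lambda>w. \<lambda>t\<in>complementary_reflections r p. w \<otimes>\<^bsub>W\<^esub> t \<otimes>\<^bsub>W\<^esub> inv\<^bsub>W\<^esub> w)"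
proof (intro transitive_action.intro transitive_action_axioms.intro
    group_action_restrictI[OF group_P, where f = "\<lambda>w t. w \<otimes>\<^bsub>W\<^esub> t \<otimes>\<^bsub>W\<^esub> inv\<^bsub>W\<^esub> w"])
  interpret group W by (rule group_W)
  have tW: "t \<in> carrier W" if "t \<in> complementary_reflections r p" for t
    using that T_bar_W by (auto simp: complementary_reflections_def)
  show "w \<otimes>\<^bsub>W\<^esub> t \<otimes>\<^bsub>W\<^esub> inv\<^bsub>W\<^esub> w \<in> complementary_reflections r p"
    if "w \<in> carrier (P_group r p)" "t \<in> complementary_reflections r p" for w t
    using that by (simp add: carrier_P conj_complementary)
  show "\<one>\<^bsub>P_group r p\<^esub> \<otimes>\<^bsub>W\<^esub> t \<otimes>\<^bsub>W\<^esub> inv\<^bsub>W\<^esub> \<one>\<^bsub>P_group r p\<^esub> = t"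
    if "t \<in> complementary_reflections r p" for t
    using tW[OF that] by (simp add: one_P)
  show "(u \<otimes>\<^bsub>P_group r p\<^esub> w) \<otimes>\<^bsub>W\<^esub> t \<otimes>\<^bsub>W\<^esub> inv\<^bsub>W\<^esub> (u \<otimes>\<^bsub>P_group r p\<^esub> w)
      = u \<otimes>\<^bsub>W\<^esub> (w \<otimes>\<^bsub>W\<^esub> t \<otimes>\<^bsub>W\<^esub> inv\<^bsub>W\<^esub> w) \<otimes>\<^bsub>W\<^esub> inv\<^bsub>W\<^esub> u"
    if "u \<in> carrier (P_group r p)" "w \<in> carrier (P_group r p)" "t \<in> complementary_reflections r p"
    for u w t
    using that(1,2) tW[OF that(3)] by (simp add: carrier_P mult_P P_W m_assoc inv_mult_group)
  show "\<exists>w\<in>carrier (P_group r p).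
      (\<lambda>t\<in>complementary_reflections r p. w \<otimes>\<^bsub>W\<^esub> t \<otimes>\<^bsub>W\<^esub> inv\<^bsub>W\<^esub> w) s = t"
    if st: "s \<in> complementary_reflections r p" "t \<in> complementary_reflections r p" for s t
  proof -
    obtain \<beta> \<gamma> where \<beta>: "\<beta> \<in> level_one_roots r p" "s = refl' \<beta>"
      and \<gamma>: "\<gamma> \<in> level_one_roots r p" "t = refl' \<gamma>"
      using st complementary_level_one[OF arms] by meson
    obtain w where w: "w \<in> P" "w \<beta> = \<gamma>"
      using level_one_transitive[OF \<beta>(1) \<gamma>(1)] by blast
    \<comment> \<open>Moving the root \<beta> to \<gamma> by \<open>w\<close> conjugates the
      reflection in \<beta> to the one in \<gamma>.\<close>
    have "w \<otimes>\<^bsub>W\<^esub> s \<otimes>\<^bsub>W\<^esub> inv\<^bsub>W\<^esub> w = t"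
      unfolding \<beta>(2) \<gamma>(2) w(2)[symmetric]
      using tW[OF st(1), unfolded \<beta>(2)] by (rule conj_reflection[OF P_W[OF w(1)] level_one_space[OF \<beta>(1)]])
    then show ?thesis
      using w(1) st(1) by (intro bexI[of _ w]) (simp_all add: carrier_P)
  qed
qed

end

theorem corollary7p3:
  fixes r :: nat and p :: "nat \<Rightarrow> nat"
  assumes "\<forall>i\<in>{1..r}. 1 \<le> p i"
  shows "transitive_action (P_group r p) (level_one_roots r p)
           (\<lambda>w. \<lambda>\<beta>\<in>level_one_roots r p. w \<beta>)
       \<and> transitive_action (P_group r p) (complementary_reflections r p)
           (\<lambda>w. \<lambda>t\<in>complementary_reflections r p.
              w \<otimes>\<^bsub>W_bar r p\<^esub> t \<otimes>\<^bsub>W_bar r p\<^esub> inv\<^bsub>W_bar r p\<^esub> w)"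
  by (intro conjI star_diagram.transitive_level_one star_diagram.transitive_complementary assms)

end
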